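(* Let $G$ be a finite simple connected graph with $m\geq 1$ edges, maximum degree $\Delta$ and minimum degree $\delta$. If $G\ncong K_2$, then $$M_{1}(G)-2m\leq SDD(\mathcal{L}(G))\leq \frac{1}{2}\left(M_{1}(G)-2m\right)\left(\frac{2\Delta-2}{\max\{2\delta-2,1\}}+\frac{\max\{2\delta-2,1\}}{2\Delta-2}\right).$$ Equality holds on the left if and only if $G$ is regular or biregular, and equality holds on the right if and only if $G\cong P_4$ or $G$ is regular.
   Context: For a finite simple graph $H$ with vertex set $V_H$ and edge set $E_H$, $d_u$ denotes the degree of vertex $u$ in $H$; the symmetric division deg index is $SDD(H)=\sum_{uv\in E_H}\left(\frac{d_u}{d_v}+\frac{d_v}{d_u}\right)$ and the first Zagreb index is $M_1(H)=\sum_{u\in V_H}d_u^2$. The line graph $\mathcal{L}(G)$ has vertex set $E_G$, two vertices being adjacent when the corresponding edges of $G$ share a common endpoint. A graph is $(\Delta,\delta)$-biregular if it is bipartite and every edge joins a vertex of degree $\Delta$ (in one part) to a vertex of degree $\delta$ (in the other part); it is biregular if it is $(\Delta,\delta)$-biregular with $\Delta$ its maximum degree and $\delta$ its minimum degree. $P_4$ is the path on $4$ vertices. *)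

theory Defs
  imports Complex_Main
begin

record 'a ugraph =
  verts :: "'a set"
  edges :: "'a set set"

definition finite_simple_graph :: "'a ugraph \<Rightarrow> bool" where
  "finite_simple_graph H \<longleftrightarrow>
     finite (verts H) \<and> (\<forall>e\<in>edges H. e \<subseteq> verts H \<and> card e = 2)"

definition connected_graph :: "'a ugraph \<Rightarrow> bool" where
  "connected_graph H \<longleftrightarrow>
     (\<forall>u\<in>verts H. \<forall>v\<in>verts H. (u, v) \<in> {(x, y). {x, y} \<in> edges H}\<^sup>*)"

definition graph_iso :: "'a ugraph \<Rightarrow> 'b ugraph \<Rightarrow> bool" (infix "\<cong>\<^sub>g" 50) where
  "G \<cong>\<^sub>g H \<longleftrightarrow>
     (\<exists>f. bij_betw f (verts G) (verts H) \<and>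
          (\<forall>u\<in>verts G. \<forall>v\<in>verts G. {u, v} \<in> edges G \<longleftrightarrow> {f u, f v} \<in> edges H))"

definition complete_graph :: "nat \<Rightarrow> nat ugraph" where
  "complete_graph n = \<lparr>verts = {..<n}, edges = {e. e \<subseteq> {..<n} \<and> card e = 2}\<rparr>"

definition path_graph :: "nat \<Rightarrow> nat ugraph" where
  "path_graph n = \<lparr>verts = {..<n}, edges = {{i, Suc i} | i. Suc i < n}\<rparr>"

definition line_graph :: "'a ugraph \<Rightarrow> 'a set ugraph" where
  "line_graph G =
     \<lparr>verts = edges G,
      edges = {{e, f} | e f. e \<in> edges G \<and> f \<in> edges G \<and> e \<noteq> f \<and> e \<inter> f \<noteq> {}}\<rparr>"

definition degree :: "'a ugraph \<Rightarrow> 'a \<Rightarrow> nat" where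
  "degree H v = card {e \<in> edges H. v \<in> e}"

definition max_degree :: "'a ugraph \<Rightarrow> nat" where
  "max_degree H = Max (degree H ` verts H)"

definition min_degree :: "'a ugraph \<Rightarrow> nat" where
  "min_degree H = Min (degree H ` verts H)"

definition regular_graph :: "'a ugraph \<Rightarrow> bool" where
  "regular_graph H \<longleftrightarrow> (\<exists>r. \<forall>v\<in>verts H. degree H v = r)"

definition biregular_with :: "'a ugraph \<Rightarrow> nat \<Rightarrow> nat \<Rightarrow> bool" where
  "biregular_with H a b \<longleftrightarrow>
     (\<exists>A B. A \<union> B = verts H \<and> A \<inter> B = {} \<and>
        (\<forall>e\<in>edges H. \<exists>u\<in>A. \<exists>v\<in>B. e = {u, v} \<and> degree H u = a \<and> degree H v = b))"

definition biregular_graph :: "'a ugraph \<Rightarrow> bool" where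
  "biregular_graph H \<longleftrightarrow> biregular_with H (max_degree H) (min_degree H)"

definition first_zagreb :: "'a ugraph \<Rightarrow> nat" where
  "first_zagreb H = (\<Sum>u\<in>verts H. (degree H u)\<^sup>2)"

text \<open>
  The inner double sum runs over both orderings of the endpoints of the edge, so an edge
  with endpoints \<open>u\<close>, \<open>v\<close> contributes the two summands \<open>d\<^sub>u / d\<^sub>v\<close> and \<open>d\<^sub>v / d\<^sub>u\<close>;
  see \<open>SDD_edge_term\<close>.
\<close>
definition SDD :: "'a ugraph \<Rightarrow> real" where
  "SDD H = (\<Sum>e\<in>edges H. \<Sum>u\<in>e. \<Sum>v\<in>e - {u}. real (degree H u) / real (degree H v))"

lemma SDD_edge_term:
  assumes "u \<noteq> v"
  shows "(\<Sum>x\<in>{u, v}. \<Sum>y\<in>{u, v} - {x}. real (degree H x) / real (degree H y)) =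
         real (degree H u) / real (degree H v) + real (degree H v) / real (degree H u)"
proof -
  have "{u, v} - {u} = {v}" "{u, v} - {v} = {u}"
    using assms by auto
  then show ?thesis
    using assms by simp
qed

lemma finite_simple_line_graph:
  assumes "finite_simple_graph G"
  shows "finite_simple_graph (line_graph G)"
proof -
  have "edges G \<subseteq> Pow (verts G)"
    using assms by (auto simp: finite_simple_graph_def)
  then have "finite (edges G)"
    using assms by (meson finite_Pow_iff finite_simple_graph_def finite_subset)
  then show ?thesis
    unfolding finite_simple_graph_def line_graph_def
    by (simp, blast intro: card_2_iff[THEN iffD2])
qed

end

theory Submission
  imports Defs
begin

text \<open>
  An edge \<open>uv\<close> of \<open>G\<close> has degree \<open>d\<^sub>u + d\<^sub>v - 2\<close> in the line graph, so the
  handshake lemma gives \<open>\<L>(G)\<close> exactly \<open>(M\<^sub>1 - 2m)/2\<close> edges. Each of them contributes a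
  value \<open>x/y + y/x\<close> with \<open>p \<le> x, y \<le> q\<close>, where \<open>p = max {2\<delta> - 2, 1}\<close> and
  \<open>q = 2\<Delta> - 2\<close>; this value is at least \<open>2\<close> and at most \<open>p/q + q/p\<close>. Equality on the left
  says that any two neighbours of a vertex have the same degree; by connectedness at most two
  degrees then occur, alternating along edges. Equality on the right says that of any two
  incident edges one has line degree \<open>q\<close>, so that both its ends have degree \<open>\<Delta>\<close>, and the other
  has line degree \<open>p\<close>. As they share an endpoint of degree \<open>\<Delta>\<close>, either \<open>\<Delta> = \<delta>\<close>, or
  \<open>\<delta> = 1\<close> and \<open>\<Delta> = 2\<close>, and then the graph is traced out to be \<open>P\<^sub>4\<close>.
\<close>

section \<open>Sums of ratios over edges\<close>

text \<open>The excess of the left-hand side over 2 is \<open>(x - y)^2 / (x * y)\<close>.\<close>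

lemma ratio_sum_ge_2:
  fixes x y :: real
  assumes "x > 0" "y > 0"
  shows "x / y + y / x \<ge> 2" "x / y + y / x = 2 \<longleftrightarrow> x = y"
proof -
  have eq: "x / y + y / x - 2 = (x - y)\<^sup>2 / (x * y)"
    using assms by (simp add: field_simps power2_eq_square)
  then show "x / y + y / x \<ge> 2"
    using assms by (smt (verit) divide_nonneg_pos mult_pos_pos zero_le_power2)
  have "x / y + y / x = 2 \<longleftrightarrow> (x - y)\<^sup>2 / (x * y) = 0"
    using eq by linarith
  then show "x / y + y / x = 2 \<longleftrightarrow> x = y"
    using assms by simp
qed

text \<open>The quotient of \<open>x\<close> and \<open>y\<close> stays between \<open>p / q\<close>
  and \<open>q / p\<close>, and t + 1/t is largest at the ends of such an interval. The proof makes
  this exact by factorising the difference of the two sides.\<close>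

lemma ratio_sum_le:
  fixes x y p q :: real
  assumes "0 < p" "p \<le> x" "x \<le> q" "p \<le> y" "y \<le> q"
  shows "x / y + y / x \<le> p / q + q / p"
    "x / y + y / x = p / q + q / p \<longleftrightarrow> x = p \<and> y = q \<or> x = q \<and> y = p"
proof -
  \<comment> \<open>Both sides are symmetric in \<open>x\<close> and \<open>y\<close>, so the case
    \<open>x \<le> y\<close> suffices.\<close>
  have main: "x / y + y / x \<le> p / q + q / p \<and>
      (x / y + y / x = p / q + q / p \<longrightarrow> x = p \<and> y = q \<or> x = q \<and> y = p)"
    if xy: "x \<le> y" and b: "p \<le> x" "y \<le> q" for x y :: real
  proof -
    have pos: "x > 0" "y > 0" "q > 0" using assms that by linarith+
    have eq: "p / q + q / p - (x / y + y / x) = (q * x - p * y) * (q * y - p * x) / (p * q * x * y)"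
      using pos \<open>0 < p\<close> by (simp add: field_simps power2_eq_square)
    \<comment> \<open>Each factor of the numerator is split into two nonnegative summands, so that
      it vanishes only if both of them do.\<close>
    have 1: "q * x - p * y = q * (x - p) + p * (q - y)" by (simp add: algebra_simps)
    have n1: "q * (x - p) \<ge> 0" "p * (q - y) \<ge> 0" using b pos \<open>0 < p\<close> by auto
    have 2: "q * y - p * x = q * (y - x) + (q - p) * x" by (simp add: algebra_simps)
    have n2: "q * (y - x) \<ge> 0" "(q - p) * x \<ge> 0" using b xy pos \<open>0 < p\<close> by auto
    have ge: "(q * x - p * y) * (q * y - p * x) \<ge> 0"
      using 1 2 n1 n2 by simp
    have "(q * x - p * y) * (q * y - p * x) / (p * q * x * y) \<ge> 0"
      using ge pos \<open>0 < p\<close> by simp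
    moreover have "x = p \<and> y = q" if "x / y + y / x = p / q + q / p"
    proof -
      have "(q * x - p * y) * (q * y - p * x) = 0"
        using eq that pos \<open>0 < p\<close> by auto
      \<comment> \<open>If the first factor vanishes, then \<open>x = p\<close> and
        \<open>y = q\<close>. If the second does, then \<open>x = y\<close> and
        \<open>p = q\<close>, and all four numbers coincide.\<close>
      then consider "q * (x - p) = 0" "p * (q - y) = 0" | "q * (y - x) = 0" "(q - p) * x = 0"
        using 1 2 n1 n2 by (smt (verit) mult_eq_0_iff)
      then show ?thesis using pos \<open>0 < p\<close> b xy by cases auto
    qed
    ultimately show ?thesis using eq by linarith
  qed
  have "x / y + y / x \<le> p / q + q / p \<and>
      (x / y + y / x = p / q + q / p \<longrightarrow> x = p \<and> y = q \<or> x = q \<and> y = p)"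
  proof (cases "x \<le> y")
    case True
    then show ?thesis using main[of x y] assms by blast
  next
    case False
    then show ?thesis using main[of y x] assms by (auto simp: add.commute)
  qed
  then show "x / y + y / x \<le> p / q + q / p"
    "x / y + y / x = p / q + q / p \<longleftrightarrow> x = p \<and> y = q \<or> x = q \<and> y = p"
    by (auto simp: add.commute)
qed

text \<open>The excesses \<open>f x - c\<close> are nonnegative, so their sum vanishes only if each
  of them does. This carries a termwise bound and its equality case over to the whole sum.\<close>

lemma sum_ge_card_mult:
  fixes f :: "'b \<Rightarrow> real"
  assumes "finite A" "\<forall>x\<in>A. c \<le> f x"
  shows "real (card A) * c \<le> sum f A"
    "sum f A = real (card A) * c \<longleftrightarrow> (\<forall>x\<in>A. f x = c)"
proof -
  have eq: "sum f A - real (card A) * c = (\<Sum>x\<in>A. f x - c)"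
    by (simp add: sum_subtractf)
  have "(\<Sum>x\<in>A. f x - c) \<ge> 0" using assms by (simp add: sum_nonneg)
  then show "real (card A) * c \<le> sum f A" using eq by linarith
  have "(\<Sum>x\<in>A. f x - c) = 0 \<longleftrightarrow> (\<forall>x\<in>A. f x - c = 0)"
    using assms by (intro sum_nonneg_eq_0_iff) auto
  then show "sum f A = real (card A) * c \<longleftrightarrow> (\<forall>x\<in>A. f x = c)"
    using eq by auto
qed

lemma finite_edges:
  assumes "finite_simple_graph H"
  shows "finite (edges H)"
proof (rule finite_subset)
  show "edges H \<subseteq> Pow (verts H)" "finite (Pow (verts H))"
    using assms unfolding finite_simple_graph_def by auto
qed

lemma edge_cases:
  assumes "finite_simple_graph H" "e \<in> edges H"
  obtains u v where "e = {u, v}" "u \<noteq> v" "u \<in> verts H" "v \<in> verts H"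
proof -
  have e: "card e = 2" "e \<subseteq> verts H" using assms unfolding finite_simple_graph_def by auto
  then obtain u v where uv: "e = {u, v}" "u \<noteq> v" unfolding card_2_iff by auto
  show ?thesis by (rule that[OF uv]) (use e uv in auto)
qed

lemma edge_verts:
  assumes "finite_simple_graph H" "{u, v} \<in> edges H"
  shows "u \<noteq> v" "u \<in> verts H" "v \<in> verts H"
proof -
  have "{u, v} \<subseteq> verts H" "card {u, v} = 2"
    using assms unfolding finite_simple_graph_def by blast+
  then show "u \<noteq> v" "u \<in> verts H" "v \<in> verts H" by auto
qed

lemma edges_ball_iff:
  assumes "finite_simple_graph H"
  shows "(\<forall>e\<in>edges H. P e) \<longleftrightarrow> (\<forall>u v. {u, v} \<in> edges H \<longrightarrow> P {u, v})"
  using edge_cases[OF assms] by metis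

text \<open>Ensures that no quotient in \<open>SDD\<close> falls under the convention
  \<open>x / 0 = 0\<close>.\<close>

lemma degree_pos:
  assumes "finite_simple_graph H" "e \<in> edges H" "u \<in> e"
  shows "degree H u > 0"
  using assms finite_edges[OF assms(1)] unfolding degree_def by (auto simp: card_gt_0_iff)

lemma SDD_lower:
  assumes H: "finite_simple_graph H"
  shows "2 * real (card (edges H)) \<le> SDD H"
    "SDD H = 2 * real (card (edges H)) \<longleftrightarrow>
      (\<forall>u v. {u, v} \<in> edges H \<longrightarrow> degree H u = degree H v)"
proof -
  let ?f = "\<lambda>e. \<Sum>u\<in>e. \<Sum>v\<in>e - {u}. real (degree H u) / real (degree H v)"
  have edge_term: "2 \<le> ?f {u, v}" "?f {u, v} = 2 \<longleftrightarrow> degree H u = degree H v"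
    if e: "{u, v} \<in> edges H" for u v
  proof -
    have pos: "real (degree H u) > 0" "real (degree H v) > 0"
      using degree_pos[OF H e] by auto
    show "2 \<le> ?f {u, v}" "?f {u, v} = 2 \<longleftrightarrow> degree H u = degree H v"
      using ratio_sum_ge_2[OF pos] unfolding SDD_edge_term[OF edge_verts(1)[OF H e]] by auto
  qed
  have ge: "\<forall>e\<in>edges H. 2 \<le> ?f e"
    unfolding edges_ball_iff[OF H] using edge_term(1) by blast
  note s = sum_ge_card_mult[OF finite_edges[OF H] ge]
  show "2 * real (card (edges H)) \<le> SDD H"
    using s(1) unfolding SDD_def by (simp add: mult.commute)
  have "SDD H = 2 * real (card (edges H)) \<longleftrightarrow> (\<forall>e\<in>edges H. ?f e = 2)"
    using s(2) unfolding SDD_def by (simp add: mult.commute)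
  also have "\<dots> \<longleftrightarrow> (\<forall>u v. {u, v} \<in> edges H \<longrightarrow> degree H u = degree H v)"
    unfolding edges_ball_iff[OF H] using edge_term(2) by blast
  finally show "SDD H = 2 * real (card (edges H)) \<longleftrightarrow>
      (\<forall>u v. {u, v} \<in> edges H \<longrightarrow> degree H u = degree H v)" .
qed

lemma SDD_upper:
  fixes p q :: real
  assumes H: "finite_simple_graph H" and "p > 0"
    and b: "\<forall>u v. {u, v} \<in> edges H \<longrightarrow> p \<le> degree H u \<and> degree H u \<le> q"
  shows "SDD H \<le> real (card (edges H)) * (p / q + q / p)"
    "SDD H = real (card (edges H)) * (p / q + q / p) \<longleftrightarrow>
      (\<forall>u v. {u, v} \<in> edges H \<longrightarrow>
        degree H u = p \<and> degree H v = q \<or> degree H u = q \<and> degree H v = p)"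
proof -
  let ?f = "\<lambda>e. \<Sum>u\<in>e. \<Sum>v\<in>e - {u}. real (degree H u) / real (degree H v)"
  let ?P = "\<lambda>u v. degree H u = p \<and> degree H v = q \<or> degree H u = q \<and> degree H v = p"
  have edge_term: "?f {u, v} \<le> p / q + q / p" "?f {u, v} = p / q + q / p \<longleftrightarrow> ?P u v"
    if e: "{u, v} \<in> edges H" for u v
  proof -
    have u: "p \<le> degree H u" "degree H u \<le> q" using b e by auto
    \<comment> \<open>The bound \<open>b\<close> speaks of the first endpoint, but it applies to
      both, since \<open>{u, v} = {v, u}\<close>.\<close>
    have v: "p \<le> degree H v" "degree H v \<le> q"
      using b[rule_format, of v u] e by (auto simp: insert_commute)
    show "?f {u, v} \<le> p / q + q / p" "?f {u, v} = p / q + q / p \<longleftrightarrow> ?P u v"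
      using ratio_sum_le[OF \<open>p > 0\<close> u v] unfolding SDD_edge_term[OF edge_verts(1)[OF H e]] by auto
  qed
  \<comment> \<open>Negating the terms turns the upper bound into the lower bound that
    \<open>sum_ge_card_mult\<close> handles.\<close>
  have ge: "\<forall>e\<in>edges H. - (p / q + q / p) \<le> - ?f e"
    unfolding edges_ball_iff[OF H] neg_le_iff_le using edge_term(1) by blast
  note s = sum_ge_card_mult[OF finite_edges[OF H] ge]
  have neg: "(\<Sum>e\<in>edges H. - ?f e) = - SDD H"
    unfolding SDD_def by (rule sum_negf)
  show "SDD H \<le> real (card (edges H)) * (p / q + q / p)"
    using s(1) unfolding neg mult_minus_right neg_le_iff_le .
  have "SDD H = real (card (edges H)) * (p / q + q / p) \<longleftrightarrow> (\<forall>e\<in>edges H. ?f e = p / q + q / p)"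
    using s(2) unfolding neg mult_minus_right neg_equal_iff_equal .
  also have "\<dots> \<longleftrightarrow> (\<forall>u v. {u, v} \<in> edges H \<longrightarrow> ?P u v)"
    unfolding edges_ball_iff[OF H] using edge_term(2) by blast
  finally show "SDD H = real (card (edges H)) * (p / q + q / p) \<longleftrightarrow>
      (\<forall>u v. {u, v} \<in> edges H \<longrightarrow> ?P u v)" .
qed

section \<open>Degrees and edges of the line graph\<close>

text \<open>Double counting of the incidences between vertices and edges, weighted by
  \<open>g\<close>. Weight 1 gives the usual handshake lemma; taking the degree as weight expresses
  the first Zagreb index as a sum over edges.\<close>

lemma handshake:
  assumes H: "finite_simple_graph H"
  shows "(\<Sum>v\<in>verts H. degree H v * g v) = (\<Sum>e\<in>edges H. \<Sum>v\<in>e. g v)"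
proof -
  have fin: "finite (verts H)" using H unfolding finite_simple_graph_def by auto
  have "(\<Sum>v\<in>verts H. degree H v * g v) = (\<Sum>v\<in>verts H. \<Sum>e | e \<in> edges H \<and> v \<in> e. g v)"
    unfolding degree_def by simp
  also have "\<dots> = (\<Sum>e\<in>edges H. \<Sum>v | v \<in> verts H \<and> v \<in> e. g v)"
    by (rule sum.swap_restrict[OF fin finite_edges[OF H]])
  also have "\<dots> = (\<Sum>e\<in>edges H. \<Sum>v\<in>e. g v)"
    using H unfolding finite_simple_graph_def
    by (intro sum.cong refl arg_cong2[where f = sum]) auto
  finally show ?thesis .
qed

text \<open>Joining \<open>v\<close> to \<open>w\<close> is a bijection from the neighbours of
  \<open>v\<close> to the edges at \<open>v\<close>.\<close>

lemma degree_eq_card_neighbours: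
  assumes G: "finite_simple_graph G"
  shows "degree G v = card {w. {v, w} \<in> edges G}" "finite {w. {v, w} \<in> edges G}"
proof -
  have "\<exists>w. e = {v, w}" if "e \<in> edges G" "v \<in> e" for e
    by (rule edge_cases[OF G that(1)]) (use that in auto)
  then have N: "{e \<in> edges G. v \<in> e} = (\<lambda>w. {v, w}) ` {w. {v, w} \<in> edges G}"
    by blast
  have inj: "inj_on (\<lambda>w. {v, w}) X" for X
    by (auto simp: inj_on_def doubleton_eq_iff)
  show "degree G v = card {w. {v, w} \<in> edges G}"
    unfolding degree_def N by (rule card_image[OF inj])
  have "{w. {v, w} \<in> edges G} \<subseteq> verts G" using edge_verts[OF G] by auto
  then show "finite {w. {v, w} \<in> edges G}"
    using G finite_subset unfolding finite_simple_graph_def by blast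
qed

lemma edge_line_graph_iff:
  "{e, f} \<in> edges (line_graph G) \<longleftrightarrow> e \<in> edges G \<and> f \<in> edges G \<and> e \<noteq> f \<and> e \<inter> f \<noteq> {}"
  unfolding line_graph_def by (auto simp: doubleton_eq_iff)

text \<open>The edges adjacent to \<open>{u, v}\<close> are the other edges at \<open>u\<close> and
  the other edges at \<open>v\<close>. These two sets are disjoint, as only \<open>{u, v}\<close>
  itself contains both endpoints. Adding 2 on the left avoids truncated subtraction.\<close>

lemma degree_line_graph:
  assumes G: "finite_simple_graph G" and e: "{u, v} \<in> edges G"
  shows "degree (line_graph G) {u, v} + 2 = degree G u + degree G v"
proof -
  let ?e = "{u, v}"
  define N where "N = (\<lambda>x. {f \<in> edges G. x \<in> f})"
  have uv: "u \<noteq> v" using edge_verts[OF G e] by simp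
  have fin: "finite (N x)" for x unfolding N_def using finite_edges[OF G] by simp
  have "f = ?e" if f: "f \<in> edges G" "u \<in> f" "v \<in> f" for f
    by (rule edge_cases[OF G f(1)]) (use f uv in auto)
  then have disj: "(N u - {?e}) \<inter> (N v - {?e}) = {}"
    unfolding N_def by auto
  have "{f. {?e, f} \<in> edges (line_graph G)} = (N u - {?e}) \<union> (N v - {?e})"
    unfolding edge_line_graph_iff N_def using e by auto
  then have "degree (line_graph G) ?e = card ((N u - {?e}) \<union> (N v - {?e}))"
    using degree_eq_card_neighbours(1)[OF finite_simple_line_graph[OF G]] by simp
  also have "\<dots> = card (N u - {?e}) + card (N v - {?e})"
    using fin disj by (intro card_Un_disjoint) auto
  also have "\<dots> = (card (N u) - 1) + (card (N v) - 1)"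
    using e unfolding N_def by simp
  finally have "degree (line_graph G) ?e = (degree G u - 1) + (degree G v - 1)"
    unfolding degree_def N_def .
  then show ?thesis using degree_pos[OF G e, of u] degree_pos[OF G e, of v] by simp
qed

text \<open>The handshake lemma is used twice: in the line graph with weight 1, and in
  \<open>G\<close> with the degree as weight. The degree formula for the line graph links the two
  sums, and its 2 for each edge yields the second summand.\<close>

lemma card_edges_line_graph:
  assumes G: "finite_simple_graph G"
  shows "2 * card (edges (line_graph G)) + 2 * card (edges G) = first_zagreb G"
proof -
  let ?L = "line_graph G"
  have L: "finite_simple_graph ?L" using finite_simple_line_graph[OF G] .
  have "(\<Sum>e\<in>verts ?L. degree ?L e * 1) = (\<Sum>x\<in>edges ?L. \<Sum>e\<in>x. 1)"
    by (rule handshake[OF L])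
  also have "\<dots> = (\<Sum>x\<in>edges ?L. 2)"
    using L unfolding finite_simple_graph_def by (intro sum.cong) auto
  finally have 1: "(\<Sum>e\<in>edges G. degree ?L e) = 2 * card (edges ?L)"
    by (simp add: line_graph_def)
  have "degree ?L e + 2 = (\<Sum>v\<in>e. degree G v)" if e: "e \<in> edges G" for e
  proof -
    obtain u v where "e = {u, v}" "u \<noteq> v" using edge_cases[OF G e] by metis
    then show ?thesis using degree_line_graph[OF G, of u v] e by simp
  qed
  then have "(\<Sum>e\<in>edges G. degree ?L e + 2) = (\<Sum>e\<in>edges G. \<Sum>v\<in>e. degree G v)"
    by (intro sum.cong) auto
  also have "\<dots> = first_zagreb G"
    unfolding first_zagreb_def power2_eq_square by (rule handshake[OF G, symmetric])
  finally show ?thesis using 1 unfolding sum.distrib by simp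
qed

text \<open>Two distinct edges with a common endpoint form a path \<open>u\<close>,
  \<open>v\<close>, \<open>w\<close>. Conditions on the edges of the line graph thus become
  conditions on such paths in \<open>G\<close>.\<close>

lemma line_edges_iff:
  assumes G: "finite_simple_graph G"
  shows "(\<forall>e f. {e, f} \<in> edges (line_graph G) \<longrightarrow> R e f) \<longleftrightarrow>
    (\<forall>u v w. {u, v} \<in> edges G \<longrightarrow> {v, w} \<in> edges G \<longrightarrow> u \<noteq> w \<longrightarrow> R {u, v} {v, w})"
    (is "?l \<longleftrightarrow> ?r")
proof
  assume l: ?l
  show ?r
  proof (intro allI impI)
    fix u v w assume "{u, v} \<in> edges G" "{v, w} \<in> edges G" "u \<noteq> w"
    then have "{{u, v}, {v, w}} \<in> edges (line_graph G)"
      unfolding edge_line_graph_iff by (auto simp: doubleton_eq_iff)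
    then show "R {u, v} {v, w}" using l by blast
  qed
next
  assume r: ?r
  show ?l
  proof (intro allI impI)
    fix e f assume "{e, f} \<in> edges (line_graph G)"
    then have ef: "e \<in> edges G" "f \<in> edges G" "e \<noteq> f" "e \<inter> f \<noteq> {}"
      unfolding edge_line_graph_iff by simp_all
    then obtain v where v: "v \<in> e" "v \<in> f" by blast
    have "\<exists>u. e = {u, v}" by (rule edge_cases[OF G ef(1)]) (use v in auto)
    then obtain u where u: "e = {u, v}" ..
    have "\<exists>w. f = {v, w}" by (rule edge_cases[OF G ef(2)]) (use v in auto)
    then obtain w where w: "f = {v, w}" ..
    have "u \<noteq> w" using ef(3) u w by (auto simp: insert_commute)
    then show "R e f" using r ef u w by blast
  qed
qed

section \<open>Degrees in connected graphs\<close>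

text \<open>A set of known neighbours that is as large as the degree must be the whole
  neighbourhood. This fixes the edges once the degrees are known.\<close>

lemma edge_iff_of_degree_le:
  assumes "finite_simple_graph G" "\<And>w. w \<in> S \<Longrightarrow> {v, w} \<in> edges G" "degree G v \<le> card S"
  shows "{v, w} \<in> edges G \<longleftrightarrow> w \<in> S"
proof -
  have "S = {w. {v, w} \<in> edges G}"
    using assms degree_eq_card_neighbours[OF assms(1), of v] by (intro card_seteq) auto
  then show ?thesis by blast
qed

text \<open>Serves to prolong a path without turning back to \<open>x\<close>.\<close>

lemma exists_other_neighbour:
  assumes "finite_simple_graph G" "degree G v \<ge> 2"
  shows "\<exists>w. w \<noteq> x \<and> {v, w} \<in> edges G"
proof (rule ccontr)
  assume "\<not> ?thesis"
  then have "{w. {v, w} \<in> edges G} \<subseteq> {x}" by blast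
  then have "card {w. {v, w} \<in> edges G} \<le> 1" using card_mono[of "{x}"] by fastforce
  then show False using assms degree_eq_card_neighbours(1)[OF assms(1), of v] by simp
qed

text \<open>Induction along a walk from \<open>x\<close> to \<open>v\<close>. It serves both to
  spread degree conditions over the graph and to show that a set closed under adjacency contains all
  vertices.\<close>

lemma connected_graph_induct:
  assumes "connected_graph G" "x \<in> verts G" "P x" "v \<in> verts G"
    and step: "\<And>x y. P x \<Longrightarrow> {x, y} \<in> edges G \<Longrightarrow> P y"
  shows "P v"
proof -
  have "(x, v) \<in> {(x, y). {x, y} \<in> edges G}\<^sup>*"
    using assms unfolding connected_graph_def by blast
  then show ?thesis
    by (induction rule: rtrancl_induct) (use assms in auto)
qed

text \<open>Having a neighbour spreads along edges, because the vertex reached is adjacent to the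
  one left. The given edge starts the induction.\<close>

lemma connected_degree_pos:
  assumes G: "finite_simple_graph G" and c: "connected_graph G" and e: "{a, b} \<in> edges G"
    and v: "v \<in> verts G"
  shows "degree G v \<ge> 1"
proof -
  have "\<exists>w. {v, w} \<in> edges G"
    by (rule connected_graph_induct[where P = "\<lambda>v. \<exists>w. {v, w} \<in> edges G",
          OF c edge_verts(2)[OF G e] _ v])
      (use e in \<open>metis insert_commute\<close>)+
  then obtain w where "{v, w} \<in> edges G" ..
  then show ?thesis using degree_pos[OF G, of "{v, w}" v] by simp
qed

lemma max_min_degree:
  assumes "finite_simple_graph G" "verts G \<noteq> {}"
  shows "\<exists>v\<in>verts G. degree G v = max_degree G" "\<exists>v\<in>verts G. degree G v = min_degree G"
    "\<And>v. v \<in> verts G \<Longrightarrow> degree G v \<le> max_degree G"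
    "\<And>v. v \<in> verts G \<Longrightarrow> min_degree G \<le> degree G v"
proof -
  have fin: "finite (degree G ` verts G)" "degree G ` verts G \<noteq> {}"
    using assms unfolding finite_simple_graph_def by auto
  show "\<exists>v\<in>verts G. degree G v = max_degree G" "\<exists>v\<in>verts G. degree G v = min_degree G"
    using Max_in[OF fin] Min_in[OF fin] unfolding max_degree_def min_degree_def
    by (auto simp: image_iff eq_commute)
  show "\<And>v. v \<in> verts G \<Longrightarrow> degree G v \<le> max_degree G"
    "\<And>v. v \<in> verts G \<Longrightarrow> min_degree G \<le> degree G v"
    using fin unfolding max_degree_def min_degree_def by auto
qed

section \<open>Recognising K_2 and P_4\<close>

text \<open>The vertices \<open>u\<close> and \<open>v\<close> are each other's only neighbours, so
  by connectedness there are no further vertices. Contrapositively, a graph other than K_2 has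
  maximum degree at least 2, which makes 2\<Delta> - 2 positive.\<close>

lemma iso_K2:
  assumes G: "finite_simple_graph G" and c: "connected_graph G" and e: "{u, v} \<in> edges G"
    and le: "\<And>x. x \<in> verts G \<Longrightarrow> degree G x \<le> 1"
  shows "G \<cong>\<^sub>g complete_graph 2"
proof -
  note uv = edge_verts[OF G e]
  have N: "{u, w} \<in> edges G \<longleftrightarrow> w \<in> {v}" "{v, w} \<in> edges G \<longleftrightarrow> w \<in> {u}" for w
    using e uv le by (intro edge_iff_of_degree_le[OF G]; simp add: insert_commute)+
  have "x \<in> {u, v}" if "x \<in> verts G" for x
    by (rule connected_graph_induct[where P = "\<lambda>x. x \<in> {u, v}", OF c uv(2) _ that]) (use N in auto)
  then have V: "verts G = {u, v}" using uv by blast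
  define f where "f = (\<lambda>x. if x = u then 0 else 1 :: nat)"
  have two: "{..<2} = {0, 1 :: nat}" by auto
  have "e = {0, 1 :: nat}" if "e \<subseteq> {0, 1}" "card e = 2" for e
    using that by (intro card_subset_eq) auto
  then have K: "verts (complete_graph 2) = {0, 1}" "edges (complete_graph 2) = {{0, 1}}"
    unfolding complete_graph_def two by auto
  have "bij_betw f (verts G) (verts (complete_graph 2))"
    unfolding V K f_def bij_betw_def inj_on_def using uv(1) by auto
  moreover have "{x, y} \<in> edges G \<longleftrightarrow> {f x, f y} \<in> edges (complete_graph 2)"
    if "x \<in> verts G" "y \<in> verts G" for x y
    using that N N(1)[of u] N(2)[of v] uv(1) unfolding V K f_def by (auto simp: doubleton_eq_iff)
  ultimately show ?thesis unfolding graph_iso_def by blast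
qed

text \<open>Replaces the isomorphism by a labelling of the vertices in path order, the form in which
  the equality case meets the path.\<close>

lemma iso_P4_iff:
  assumes G: "finite_simple_graph G"
  shows "G \<cong>\<^sub>g path_graph 4 \<longleftrightarrow> (\<exists>a b c d. distinct [a, b, c, d] \<and> verts G = {a, b, c, d} \<and>
    edges G = {{a, b}, {b, c}, {c, d}})"
proof -
  have "{..<4::nat} = {0, 1, 2, 3}" by auto
  then have V: "verts (path_graph 4) = {0, 1, 2, 3}" unfolding path_graph_def by simp
  have "{{i, Suc i} | i. Suc i < 4} = (\<lambda>i. {i, Suc i}) ` {0, 1, 2}" by auto
  then have E: "edges (path_graph 4) = {{0, 1}, {1, 2}, {2, 3}}"
    unfolding path_graph_def by (simp add: numeral_2_eq_2 numeral_3_eq_3)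
  show ?thesis
  proof
    assume "G \<cong>\<^sub>g path_graph 4"
    then obtain f where f: "bij_betw f (verts G) {0, 1, 2, 3 :: nat}"
      and fe: "\<forall>u\<in>verts G. \<forall>v\<in>verts G.
        {u, v} \<in> edges G \<longleftrightarrow> {f u, f v} \<in> {{0, 1}, {1, 2}, {2, 3}}"
      unfolding graph_iso_def V E by blast
    define g where "g = inv_into (verts G) f"
    have g: "bij_betw g {0, 1, 2, 3} (verts G)" unfolding g_def by (rule bij_betw_inv_into[OF f])
    have Vg: "verts G = {g 0, g 1, g 2, g 3}"
      using g unfolding bij_betw_def by auto
    have d: "distinct [g 0, g 1, g 2, g 3]"
      using g unfolding bij_betw_def inj_on_def by auto
    have fg: "f (g 0) = 0" "f (g 1) = 1" "f (g 2) = 2" "f (g 3) = 3"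
      unfolding g_def using f by (auto intro!: bij_betw_inv_into_right)
    have "e \<in> edges G \<longleftrightarrow> e \<in> {{g 0, g 1}, {g 1, g 2}, {g 2, g 3}}" for e
    proof
      assume e: "e \<in> edges G"
      obtain x y where xy: "e = {x, y}" "x \<in> verts G" "y \<in> verts G"
        using edge_cases[OF G e] by metis
      then show "e \<in> {{g 0, g 1}, {g 1, g 2}, {g 2, g 3}}"
        using fe[rule_format, OF xy(2,3)] e fg xy unfolding Vg by (auto simp: doubleton_eq_iff)
    next
      assume "e \<in> {{g 0, g 1}, {g 1, g 2}, {g 2, g 3}}"
      then show "e \<in> edges G"
        using fe[rule_format, of "g 0" "g 1"] fe[rule_format, of "g 1" "g 2"]
          fe[rule_format, of "g 2" "g 3"] fg Vg
        by (elim insertE emptyE) simp_all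
    qed
    then show "\<exists>a b c d. distinct [a, b, c, d] \<and> verts G = {a, b, c, d} \<and>
        edges G = {{a, b}, {b, c}, {c, d}}"
      using Vg d by blast
  next
    assume "\<exists>a b c d. distinct [a, b, c, d] \<and> verts G = {a, b, c, d} \<and>
        edges G = {{a, b}, {b, c}, {c, d}}"
    then obtain a b c d where d: "distinct [a, b, c, d]" and VG: "verts G = {a, b, c, d}"
      and EG: "edges G = {{a, b}, {b, c}, {c, d}}" by (elim exE conjE) (rule that)
    define f where
      "f = (\<lambda>x. if x = a then 0 else if x = b then 1 else if x = c then 2 else 3 :: nat)"
    have fv: "f a = 0" "f b = 1" "f c = 2" "f d = 3" using d unfolding f_def by auto
    have ne: "a \<noteq> b" "a \<noteq> c" "a \<noteq> d" "b \<noteq> c" "b \<noteq> d" "c \<noteq> d" using d by auto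
    have "bij_betw f (verts G) (verts (path_graph 4))"
      unfolding VG V bij_betw_def inj_on_def using fv by auto
    moreover have "{x, y} \<in> edges G \<longleftrightarrow> {f x, f y} \<in> edges (path_graph 4)"
      if "x \<in> verts G" "y \<in> verts G" for x y
      using that unfolding VG
      by (elim insertE emptyE; simp add: fv EG E doubleton_eq_iff ne ne[symmetric])
    ultimately show "G \<cong>\<^sub>g path_graph 4"
      unfolding graph_iso_def by (intro exI[of _ f] conjI ballI)
  qed
qed

section \<open>The equality cases\<close>

text \<open>From left to right, the end degrees of one edge spread over the connected graph. From
  right to left, in both kinds of graph all edges have the same sum of end degrees, so two
  neighbours of \<open>v\<close> have equal degree.\<close>

lemma regular_or_biregular_iff:
  assumes G: "finite_simple_graph G" and c: "connected_graph G" and e: "{u\<^sub>0, v\<^sub>0} \<in> edges G"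
  shows "(\<forall>u v w. {u, v} \<in> edges G \<longrightarrow> {v, w} \<in> edges G \<longrightarrow> degree G u = degree G w) \<longleftrightarrow>
    regular_graph G \<or> biregular_graph G" (is "?l \<longleftrightarrow> ?r")
proof
  assume l: ?l
  define a b where "a = degree G u\<^sub>0" and "b = degree G v\<^sub>0"
  \<comment> \<open>The invariant also records the degrees of the neighbours; without them it would
    not pass along an edge.\<close>
  let ?P = "\<lambda>x. degree G x = a \<and> (\<forall>y. {x, y} \<in> edges G \<longrightarrow> degree G y = b) \<or>
    degree G x = b \<and> (\<forall>y. {x, y} \<in> edges G \<longrightarrow> degree G y = a)"
  note u0 = edge_verts[OF G e]
  have P: "?P x" if "x \<in> verts G" for x
  proof (rule connected_graph_induct[where P = ?P, OF c u0(2) _ that])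
    show "?P u\<^sub>0" using l e unfolding a_def b_def by (metis insert_commute)
    show "?P y" if "?P x" "{x, y} \<in> edges G" for x y using l that by metis
  qed
  have ends: "{degree G x, degree G y} = {a, b}" if "{x, y} \<in> edges G" for x y
    using P[OF edge_verts(2)[OF G that]] that by blast
  have deg: "degree G ` verts G = {a, b}"
    using P u0 unfolding a_def b_def by blast
  show ?r
  proof (cases "a = b")
    case True
    then have "\<forall>v\<in>verts G. degree G v = a" using deg by blast
    then show ?thesis unfolding regular_graph_def by blast
  next
    case False
    have M: "max_degree G = max a b" "min_degree G = min a b"
      unfolding max_degree_def min_degree_def deg by auto
    \<comment> \<open>The parts are the two degree classes, ordered so that the maximum degree comes
      first as in \<open>biregular_graph\<close>. They are disjoint because \<open>a\<close> and
      \<open>b\<close> differ.\<close>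
    define A B where "A = {v \<in> verts G. degree G v = max a b}"
      and "B = {v \<in> verts G. degree G v = min a b}"
    have "A \<union> B = verts G" "A \<inter> B = {}"
      using deg False unfolding A_def B_def by (auto simp: max_def min_def)
    moreover have "\<exists>u\<in>A. \<exists>v\<in>B. f = {u, v} \<and> degree G u = max a b \<and> degree G v = min a b"
      if f: "f \<in> edges G" for f
    proof -
      obtain x y where xy: "f = {x, y}" "x \<in> verts G" "y \<in> verts G"
        using edge_cases[OF G f] by metis
      have "{degree G x, degree G y} = {max a b, min a b}"
        using ends f xy(1) by (auto simp: max_def min_def)
      then consider "x \<in> A" "y \<in> B" | "x \<in> B" "y \<in> A"
        using xy unfolding A_def B_def doubleton_eq_iff by blast
      then show ?thesis
        using xy(1) unfolding A_def B_def by cases (blast, simp, metis insert_commute)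
    qed
    ultimately have "biregular_with G (max a b) (min a b)"
      unfolding biregular_with_def by (intro exI[of _ A] exI[of _ B] conjI ballI)
    then show ?thesis unfolding biregular_graph_def M by simp
  qed
next
  assume ?r
  then obtain s where s: "\<And>u v. {u, v} \<in> edges G \<Longrightarrow> degree G u + degree G v = s"
  proof (elim disjE)
    assume "regular_graph G"
    then obtain r where "\<forall>v\<in>verts G. degree G v = r" unfolding regular_graph_def by blast
    then show ?thesis using that[of "r + r"] edge_verts[OF G] by metis
  next
    assume "biregular_graph G"
    then have "degree G u + degree G v = max_degree G + min_degree G" if "{u, v} \<in> edges G" for u v
      using that unfolding biregular_graph_def biregular_with_def by (fastforce simp: doubleton_eq_iff)
    then show ?thesis using that by blast
  qed
  show ?l
  proof (intro allI impI)
    fix u v w assume "{u, v} \<in> edges G" "{v, w} \<in> edges G"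
    then show "degree G u = degree G w" using s[of u v] s[of v w] by simp
  qed
qed

text \<open>For the forward direction, look at a path centred at a vertex \<open>b\<close> of
  maximum degree. Its edge of line degree \<open>q\<close> leads to another vertex of maximum
  degree, and its edge of line degree \<open>p\<close> ties the maximum degree to the minimum
  degree.\<close>

lemma P4_or_regular_iff:
  assumes G: "finite_simple_graph G" and c: "connected_graph G" and e: "{u\<^sub>0, v\<^sub>0} \<in> edges G"
    and Delta: "max_degree G \<ge> 2"
    and p: "p = max (2 * min_degree G - 2) 1" and q: "q = 2 * max_degree G - 2"
  defines "L \<equiv> degree (line_graph G)"
  shows "(\<forall>u v w. {u, v} \<in> edges G \<longrightarrow> {v, w} \<in> edges G \<longrightarrow> u \<noteq> w \<longrightarrow>
      L {u, v} = p \<and> L {v, w} = q \<or> L {u, v} = q \<and> L {v, w} = p) \<longleftrightarrow>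
    G \<cong>\<^sub>g path_graph 4 \<or> regular_graph G" (is "?l \<longleftrightarrow> ?r")
proof -
  note u0 = edge_verts[OF G e]
  then have "verts G \<noteq> {}" by blast
  note D = max_min_degree[OF G this]
  note Ldeg = degree_line_graph[OF G, folded L_def]
  note dpos = connected_degree_pos[OF G c e]
  have delta: "min_degree G \<ge> 1" using D(2) dpos by metis
  show ?thesis
  proof
    assume l: ?l
    obtain b where b: "b \<in> verts G" "degree G b = max_degree G" using D(1) by blast
    obtain a0 where a0: "{b, a0} \<in> edges G" using exists_other_neighbour[OF G] b Delta by metis
    obtain c0 where c0: "{b, c0} \<in> edges G" "c0 \<noteq> a0"
      using exists_other_neighbour[OF G] b Delta by metis
    have "L {a0, b} = p \<and> L {b, c0} = q \<or> L {a0, b} = q \<and> L {b, c0} = p"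
      using l a0 c0 by (metis insert_commute)
    \<comment> \<open>The two neighbours are named so that the edge to \<open>a\<close> has line
      degree \<open>p\<close> and the edge to \<open>c\<close> has line degree
      \<open>q\<close>.\<close>
    then obtain a c where ab: "{a, b} \<in> edges G" and bc: "{b, c} \<in> edges G" and ac: "a \<noteq> c"
      and La: "L {a, b} = p" and Lc: "L {b, c} = q"
    proof (elim disjE conjE)
      assume "L {a0, b} = p" "L {b, c0} = q"
      then show ?thesis using that[of a0 c0] a0 c0 by (simp add: insert_commute)
    next
      assume "L {a0, b} = q" "L {b, c0} = p"
      then show ?thesis using that[of c0 a0] a0 c0 by (simp add: insert_commute)
    qed
    note av = edge_verts[OF G ab] and cv = edge_verts[OF G bc]
    have dc: "degree G c = max_degree G"
      using Ldeg[OF bc] Lc D(3)[OF cv(3)] Delta b(2) unfolding q by linarith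
    have da: "degree G a + max_degree G = p + 2" using Ldeg[OF ab] La b(2) by simp
    have da1: "degree G a \<ge> min_degree G" using D(4)[OF av(2)] .
    have le: "min_degree G \<le> max_degree G" using D(4)[OF b(1)] b(2) by simp
    show ?r
    proof (cases "min_degree G \<ge> 2")
      case True
      \<comment> \<open>Here p = 2\<delta> - 2, so the degree of \<open>a\<close> and \<Delta> add
        up to 2\<delta> while neither is below \<delta>.\<close>
      then have "max_degree G = min_degree G" using da da1 le unfolding p by linarith
      then have "\<forall>v\<in>verts G. degree G v = max_degree G" using D(3,4) by (metis le_antisym)
      then show ?thesis unfolding regular_graph_def by blast
    next
      case False
      then have "p = 1" using p by simp
      \<comment> \<open>Now the degree of \<open>a\<close> and \<Delta> add up to 3, with the former
        at least 1 and the latter at least 2.\<close>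
      then have D2: "max_degree G = 2" and a1: "degree G a = 1"
        using da da1 delta Delta by linarith+
      have "q = 2" using q D2 by simp
      obtain d where cd: "{c, d} \<in> edges G" and db: "d \<noteq> b"
        using exists_other_neighbour[OF G] dc Delta by metis
      note dv = edge_verts[OF G cd]
      \<comment> \<open>On the path \<open>b\<close>, \<open>c\<close>, \<open>d\<close> the first
        edge has line degree \<open>q = 2\<close>, so the second must have
        \<open>p = 1\<close>.\<close>
      have "L {c, d} = 1"
        using l bc cd db Lc \<open>p = 1\<close> \<open>q = 2\<close> by (metis numeral_eq_one_iff semiring_norm(85))
      then have d1: "degree G d = 1" using Ldeg[OF cd] dc D2 by simp
      \<comment> \<open>Otherwise \<open>a\<close>, \<open>b\<close>, \<open>c\<close> would form a
        triangle, but \<open>b\<close> is the only neighbour of \<open>a\<close>.\<close>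
      have da': "d \<noteq> a"
      proof
        assume "d = a"
        then have "{a, c} \<in> edges G" using cd by (simp add: insert_commute)
        moreover have "{a, c} \<in> edges G \<longleftrightarrow> c \<in> {b}"
          using ab a1 by (intro edge_iff_of_degree_le[OF G]) auto
        ultimately show False using cv(1) by simp
      qed
      \<comment> \<open>The neighbours found so far exhaust the degrees 1, 2, 2, 1, so
        \<open>{a, b, c, d}\<close> is closed under adjacency.\<close>
      have "{a, w} \<in> edges G \<longleftrightarrow> w \<in> {b}" "{b, w} \<in> edges G \<longleftrightarrow> w \<in> {a, c}"
        "{c, w} \<in> edges G \<longleftrightarrow> w \<in> {b, d}" "{d, w} \<in> edges G \<longleftrightarrow> w \<in> {c}" for w
        by (intro edge_iff_of_degree_le[OF G];
            use ab bc cd a1 d1 dc b(2) D2 ac db in \<open>auto simp: insert_commute\<close>)+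
      note N = this[unfolded insert_iff empty_iff simp_thms]
      have "x \<in> {a, b, c, d}" if "x \<in> verts G" for x
      proof (rule connected_graph_induct[where P = "\<lambda>x. x \<in> {a, b, c, d}",
            OF \<open>connected_graph G\<close> b(1) _ that])
        show "y \<in> {a, b, c, d}" if "x \<in> {a, b, c, d}" "{x, y} \<in> edges G" for x y
          using that(1) by (elim insertE emptyE; use that(2) in \<open>simp add: N\<close>) blast+
      qed simp
      then have V: "verts G = {a, b, c, d}" using av cv dv by blast
      have "f \<in> {{a, b}, {b, c}, {c, d}}" if f: "f \<in> edges G" for f
      proof -
        obtain x y where xy: "f = {x, y}" "x \<in> verts G" "y \<in> verts G"
          using edge_cases[OF G f] by metis
        have "{x, y} \<in> edges G" using f xy(1) by simp
        with xy(2) show ?thesis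
          unfolding V xy(1) by (elim insertE emptyE) (auto simp: N)
      qed
      then have "edges G \<subseteq> {{a, b}, {b, c}, {c, d}}" by (rule subsetI)
      moreover have "{{a, b}, {b, c}, {c, d}} \<subseteq> edges G" using ab bc cd by simp
      ultimately have E: "edges G = {{a, b}, {b, c}, {c, d}}" by (rule equalityI)
      have "distinct [a, b, c, d]" using av cv dv ac db da' by auto
      then show ?thesis unfolding iso_P4_iff[OF G] using V E by (intro disjI1 exI conjI)
    qed
  next
    assume ?r
    then show ?l
    proof (elim disjE)
      assume "regular_graph G"
      then obtain r where r: "\<And>v. v \<in> verts G \<Longrightarrow> degree G v = r" unfolding regular_graph_def by blast
      then have "max_degree G = r" "min_degree G = r" using D(1,2) by metis+
      \<comment> \<open>Since \<open>r\<close> is at least 2, the maximum in \<open>p\<close> is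
        attained by its first argument.\<close>
      then have "p = 2 * r - 2" "q = 2 * r - 2" using p q Delta by auto
      moreover have "L {u, v} = 2 * r - 2" if "{u, v} \<in> edges G" for u v
        using Ldeg[OF that] r edge_verts[OF G that] by simp
      ultimately show ?l by simp
    next
      assume "G \<cong>\<^sub>g path_graph 4"
      then have "\<exists>a b c d. distinct [a, b, c, d] \<and> verts G = {a, b, c, d} \<and>
          edges G = {{a, b}, {b, c}, {c, d}}"
        unfolding iso_P4_iff[OF G] .
      then obtain a b c d where dist: "distinct [a, b, c, d]" and V: "verts G = {a, b, c, d}"
        and E: "edges G = {{a, b}, {b, c}, {c, d}}" by (elim exE conjE) (rule that)
      have "{w. {a, w} \<in> edges G} = {b}" "{w. {b, w} \<in> edges G} = {a, c}"
        "{w. {c, w} \<in> edges G} = {b, d}" "{w. {d, w} \<in> edges G} = {c}"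
        using dist unfolding E by (auto simp: doubleton_eq_iff)
      then have deg: "degree G a = 1" "degree G b = 2" "degree G c = 2" "degree G d = 1"
        using dist unfolding degree_eq_card_neighbours(1)[OF G] by auto
      then have "degree G ` verts G = {1, 2}" unfolding V by auto
      then have "max_degree G = 2" "min_degree G = 1" unfolding max_degree_def min_degree_def by auto
      then have pq: "p = 1" "q = 2" using p q by auto
      have L: "L {a, b} = 1" "L {b, c} = 2" "L {c, d} = 1"
        using Ldeg[of a b] Ldeg[of b c] Ldeg[of c d] deg E by auto
      have L1: "L f = 1" if "f \<in> edges G" "f \<noteq> {b, c}" for f
        using that L(1,3) unfolding E by (elim insertE emptyE) simp_all
      show ?l
      proof (intro allI impI)
        fix u v w assume uv: "{u, v} \<in> edges G" and vw: "{v, w} \<in> edges G" and "u \<noteq> w"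
        \<comment> \<open>Of two distinct edges of the path that meet, exactly one is the middle
          edge, the only one of line degree 2.\<close>
        then consider "{u, v} = {b, c}" "{v, w} \<noteq> {b, c}" | "{u, v} \<noteq> {b, c}" "{v, w} = {b, c}"
          using dist unfolding E by (auto simp: doubleton_eq_iff)
        then show "L {u, v} = p \<and> L {v, w} = q \<or> L {u, v} = q \<and> L {v, w} = p"
          by cases (use L1 uv vw L(2) pq in simp_all)
      qed
    qed
  qed
qed

section \<open>The bounds for the line graph\<close>

theorem theorem4p3:
  fixes G :: "'a ugraph" and m \<Delta> \<delta> :: nat
  assumes "finite_simple_graph G"
    and "connected_graph G"
    and "m = card (edges G)" and "m \<ge> 1"
    and "\<Delta> = max_degree G" and "\<delta> = min_degree G"
    and "\<not> G \<cong>\<^sub>g complete_graph 2"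
  shows "(real (first_zagreb G) - 2 * real m \<le> SDD (line_graph G)) \<and>
         (SDD (line_graph G) \<le>
           1 / 2 * (real (first_zagreb G) - 2 * real m) *
           ((2 * real \<Delta> - 2) / max (2 * real \<delta> - 2) 1 +
            max (2 * real \<delta> - 2) 1 / (2 * real \<Delta> - 2))) \<and>
         (real (first_zagreb G) - 2 * real m = SDD (line_graph G) \<longleftrightarrow>
           regular_graph G \<or> biregular_graph G) \<and>
         (SDD (line_graph G) =
           1 / 2 * (real (first_zagreb G) - 2 * real m) *
           ((2 * real \<Delta> - 2) / max (2 * real \<delta> - 2) 1 +
            max (2 * real \<delta> - 2) 1 / (2 * real \<Delta> - 2)) \<longleftrightarrow>
           G \<cong>\<^sub>g path_graph 4 \<or> regular_graph G)"
proof -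
  note G = assms(1) and c = assms(2)
  let ?L = "line_graph G"
  note L = finite_simple_line_graph[OF G]
  have "edges G \<noteq> {}" using assms(3,4) by auto
  then obtain u\<^sub>0 v\<^sub>0 where e: "{u\<^sub>0, v\<^sub>0} \<in> edges G"
    using edge_cases[OF G] by (metis ex_in_conv)
  have ne: "verts G \<noteq> {}" using edge_verts[OF G e] by blast
  note D = max_min_degree[OF G ne]
  have Delta: "max_degree G \<ge> 2"
  proof (rule ccontr)
    assume "\<not> ?thesis"
    then have "degree G x \<le> 1" if "x \<in> verts G" for x using D(3)[OF that] by linarith
    then show False using iso_K2[OF G c e] assms(7) by blast
  qed
  have delta: "min_degree G \<ge> 1" using D(2) connected_degree_pos[OF G c e] by metis
  define p q where "p = max (2 * min_degree G - 2) 1" and "q = 2 * max_degree G - 2"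
  \<comment> \<open>The natural subtractions in \<open>p\<close> and \<open>q\<close> are not
    truncated, as \<delta> is at least 1 and \<Delta> at least 2.\<close>
  have pq: "max (2 * real \<delta> - 2) 1 = real p" "2 * real \<Delta> - 2 = real q"
    unfolding p_def q_def assms(5,6) using delta Delta by (auto simp: of_nat_diff max_def)
  have M: "real (first_zagreb G) - 2 * real m = 2 * real (card (edges ?L))"
    using card_edges_line_graph[OF G] unfolding assms(3) by linarith
  have "real p > 0" unfolding p_def by simp
  have bounds: "\<forall>x y. {x, y} \<in> edges ?L \<longrightarrow>
      real p \<le> real (degree ?L x) \<and> real (degree ?L x) \<le> real q"
  proof (intro allI impI)
    fix x y assume xy: "{x, y} \<in> edges ?L"
    have "x \<in> edges G" using edge_verts(2)[OF L xy] unfolding line_graph_def by simp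
    then obtain u v where uv: "x = {u, v}" "u \<in> verts G" "v \<in> verts G" "{u, v} \<in> edges G"
      using edge_cases[OF G] by metis
    \<comment> \<open>This gives the 1 in the maximum defining \<open>p\<close>; the degree formula
      gives the bounds 2\<delta> - 2 and 2\<Delta> - 2.\<close>
    have "degree ?L x > 0" using degree_pos[OF L xy] by simp
    then show "real p \<le> real (degree ?L x) \<and> real (degree ?L x) \<le> real q"
      using degree_line_graph[OF G uv(4)] D(3,4)[OF uv(2)] D(3,4)[OF uv(3)]
      unfolding uv(1) p_def q_def by auto
  qed
  note up = SDD_upper[OF L \<open>real p > 0\<close> bounds]
  have lo: "SDD ?L = 2 * real (card (edges ?L)) \<longleftrightarrow> regular_graph G \<or> biregular_graph G"
  proof -
    have "degree ?L {u, v} = degree ?L {v, w} \<longleftrightarrow> degree G u = degree G w"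
      if "{u, v} \<in> edges G" "{v, w} \<in> edges G" for u v w
      using degree_line_graph[OF G that(1)] degree_line_graph[OF G that(2)] by linarith
    \<comment> \<open>The paths coming from the line graph have \<open>u \<noteq> w\<close>; for
      \<open>u = w\<close> the equality of degrees is trivial.\<close>
    then show ?thesis
      unfolding SDD_lower(2)[OF L] line_edges_iff[OF G] regular_or_biregular_iff[OF G c e, symmetric]
      by metis
  qed
  have hi: "SDD ?L = real (card (edges ?L)) * (real p / real q + real q / real p) \<longleftrightarrow>
      G \<cong>\<^sub>g path_graph 4 \<or> regular_graph G"
    unfolding up(2) line_edges_iff[OF G] of_nat_eq_iff
    by (rule P4_or_regular_iff[OF G c e Delta p_def q_def])
  have rhs: "1 / 2 * (2 * real (card (edges ?L))) * (real q / real p + real p / real q) =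
      real (card (edges ?L)) * (real p / real q + real q / real p)"
    by (simp add: add.commute)
  show ?thesis
    unfolding M pq rhs using SDD_lower(1)[OF L] up(1) lo hi by (auto simp: eq_commute)
qed

end
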